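(* For every closed System T term $t:(\iota\to\iota)\to\iota$, the auxiliary term $N_t=Q_{K(t)}(M_t)$ is closed, ground (of type $\iota$), and $\beta$-normal, and $[\![N_t]\!]^\infty=D(t)$. Here $M_t=\widehat{t\,\Omega}$ is the infinitary translation of $t\,\Omega$, $K(t)=B(t\,\Omega)$, and $Q_r$ executes the degree-elimination passes $P_r,P_{r-1},\dots,P_1$ in that order, all as defined in the context.
   Context: **Source language.** Simple types: $\sigma,\tau::=\iota\mid\sigma\to\tau$ (arrows associate to the right). System T terms are simply typed $\lambda$-terms, up to renaming of bound variables, over the constants $\mathsf 0:\iota$, $\mathsf{succ}:\iota\to\iota$, $\mathsf{Rec}_\sigma:(\iota\to\sigma\to\sigma)\to\sigma\to\iota\to\sigma$ for every type $\sigma$. The extended source language adds $\Omega:\iota\to\iota$. **Dialogue trees.** For a set $X$, $\mathcal D(X)$ is inductively generated by leaves $\eta(x)$ ($x\in X$) and nodes $\beta_i(\varphi)$ ($i\in\mathbb N$, $\varphi:\mathbb N\to\mathcal D(X)$). Grafting: $\eta(x)\gg\!\!=g\;=\;g(x)$, $\beta_i(\varphi)\gg\!\!=g\;=\;\beta_i(n\mapsto\varphi(n)\gg\!\!=g)$ for $g:X\to\mathcal D(Y)$. Put $\mathrm{map}(f,d)=d\gg\!\!=(x\mapsto\eta(f(x)))$. **Dialogue interpretation.** $V_\iota=\mathcal D(\mathbb N)$, $V_{\sigma\to\tau}=V_\sigma\to V_\tau$; a valuation $\gamma$ for $\Gamma$ assigns $\gamma(x)\in V_\sigma$ to each $x:\sigma$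 in $\Gamma$. Typed grafting for $d\in\mathcal D(X)$, $g:X\to V_\sigma$: $d\gg\!\!=_\iota g=d\gg\!\!=g$, $(d\gg\!\!=_{\sigma\to\tau}g)(a)=d\gg\!\!=_\tau(x\mapsto g(x)(a))$. $[\![x]\!]^D_\gamma=\gamma(x)$; $[\![\lambda x^\sigma.t]\!]^D_\gamma(a)=[\![t]\!]^D_{\gamma[x\mapsto a]}$; $[\![t\,u]\!]^D_\gamma=[\![t]\!]^D_\gamma([\![u]\!]^D_\gamma)$; $[\![\mathsf 0]\!]^D=\eta(0)$; $[\![\mathsf{succ}]\!]^D(d)=\mathrm{map}(n\mapsto n+1,d)$; $[\![\mathsf{Rec}_\sigma]\!]^D(f)(a)(d)=d\gg\!\!=_\sigma(n\mapsto v_n)$, where $v_0=a$, $v_{n+1}=f(\eta(n))(v_n)$. With $\mathsf{gen}(d)=d\gg\!\!=(i\mapsto\beta_i(n\mapsto\eta(n)))$, set $D(t)=[\![t]\!]^D(\mathsf{gen})$ for closed $t:(\iota\to\iota)\to\iota$. **Auxiliary (infinitary) terms.** Same types and contexts. Terms are inductively generated (well-founded, possibly countably branching), up to renaming of bound variables, by variables, abstraction, application with the usual typing, literals $\Gamma\vdash\underline n:\iota$ ($n\in\mathbb N$), queries $\Gamma\vdash\mathsf{query}_i(n\mapsto M_n):\iota$ ($i\in\mathbb N$, $\Gamma\vdash M_n:\iota$ for all $n\in\mathbb N$), and selections $\Gamma\vdash\mathsf{case}(M;\,n\mapsto M_n):\iota$ ($\Gamma\vdash M:\iota$, $\Gamma\vdash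 M_n:\iota$ for all $n$). Capture-avoiding substitution extends to selectors and all branches. Semantics $[\![M]\!]^\infty_\gamma$: variables, abstraction, application as for $[\![\cdot]\!]^D$; $[\![\underline n]\!]^\infty_\gamma=\eta(n)$; $[\![\mathsf{query}_i(n\mapsto M_n)]\!]^\infty_\gamma=\beta_i(n\mapsto[\![M_n]\!]^\infty_\gamma)$; $[\![\mathsf{case}(M;n\mapsto M_n)]\!]^\infty_\gamma=[\![M]\!]^\infty_\gamma\gg\!\!=(n\mapsto[\![M_n]\!]^\infty_\gamma)$. A term is $\beta$-normal if it has no subterm of the form $(\lambda x^\sigma.U)\,V$ (including under abstractions and in every branch). **Derived selection.** $\mathsf{case}_\iota=\mathsf{case}$; $\mathsf{case}_{\sigma\to\tau}(M;n\mapsto M_n)=\lambda x^\sigma.\mathsf{case}_\tau(M;n\mapsto M_n\,x)$ with $x$ fresh. **Translation $u\mapsto\widehat u$.** Let $I_0(f,a)=a$, $I_{n+1}(f,a)=f\,\underline n\,(I_n(f,a))$, $R^\infty_\sigma=\lambda f^{\iota\to\sigma\to\sigma}\,a^\sigma\,z^\iota.\,\mathsf{case}_\sigma(z;\,n\mapsto I_n(f,a))$. Then $\widehat{\mathsf 0}=\underline 0$; $\widehat{\mathsf{Rec}_\sigma}=R^\infty_\sigma$; $\widehat{\mathsf{succ}}=\lambda z^\iota.\mathsf{case}(z;n\mapsto\underline{n+1})$; $\widehat\Omega=\lambda z^\iota.\mathsf{case}(z;i\mapsto\mathsf{query}_i(n\mapsto\underline n))$; $\widehat x=x$; $\widehat{\lambda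 x^\sigma.u}=\lambda x^\sigma.\widehat u$; $\widehat{u\,v}=\widehat u\,\widehat v$. **Levels and ceiling.** $\mathrm{lev}(\iota)=0$, $\mathrm{lev}(\sigma\to\tau)=\max\{\mathrm{lev}(\sigma)+1,\mathrm{lev}(\tau)\}$. On extended source terms: $B(\mathsf 0)=0$; $B(\mathsf{succ})=B(\Omega)=1$; $B(x)=\mathrm{lev}(\sigma)$ for a variable $x:\sigma$; $B(\mathsf{Rec}_\sigma)=\mathrm{lev}((\iota\to\sigma\to\sigma)\to\sigma\to\iota\to\sigma)$; $B(\lambda x^\sigma.u)=\max\{\mathrm{lev}(\sigma\to\tau),B(u)\}$ for $u:\tau$; $B(u\,v)=\max\{\mathrm{lev}(\tau),B(u),B(v)\}$ for $u:\sigma\to\tau$, $v:\sigma$. $K(t)=B(t\,\Omega)$. **Passes.** For $r\in\mathbb N$, $P_r$ on auxiliary terms is defined by structural recursion: it fixes variables and literals; $P_r(\lambda x^\sigma.M)=\lambda x^\sigma.P_rM$; $P_r(\mathsf{query}_i(n\mapsto M_n))=\mathsf{query}_i(n\mapsto P_rM_n)$; $P_r(\mathsf{case}(M;n\mapsto M_n))=\mathsf{case}(P_rM;n\mapsto P_rM_n)$; and for $F:\sigma\to\tau$, with $F'=P_rF$, $V'=P_rV$: $P_r(F\,V)=U'[V'/x]$ if $F'=\lambda x^\sigma.U'$ and $\mathrm{lev}(\sigma\to\tau)=r$, and $P_r(F\,V)=F'\,V'$ otherwise. Put $Q_0(M)=M$, $Q_{r+1}(M)=Q_r(P_{r+1}M)$.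 *)

theory Defs
  imports "HOL-Library.FuncSet"
begin

section \<open>Types and dialogue trees\<close>

datatype ty = Iota | Fun ty ty  (infixr "\<Rrightarrow>" 65)

primrec lev :: "ty \<Rightarrow> nat" where
  "lev Iota = 0"
| "lev (\<sigma> \<Rrightarrow> \<tau>) = max (lev \<sigma> + 1) (lev \<tau>)"

text \<open>Junk on the ground type.\<close>
primrec cod :: "ty \<Rightarrow> ty" where
  "cod Iota = Iota"
| "cod (\<sigma> \<Rrightarrow> \<tau>) = \<tau>"

datatype 'x dtree = Leaf 'x | Node nat "nat \<Rightarrow> 'x dtree"

primrec graft :: "'x dtree \<Rightarrow> ('x \<Rightarrow> 'y dtree) \<Rightarrow> 'y dtree" where
  "graft (Leaf x) g = g x"
| "graft (Node i \<phi>) g = Node i (\<lambda>n. graft (\<phi> n) g)"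

definition tree_map :: "('x \<Rightarrow> 'y) \<Rightarrow> 'x dtree \<Rightarrow> 'y dtree" where
  "tree_map f d = graft d (\<lambda>x. Leaf (f x))"


section \<open>The full type hierarchy over dialogue trees\<close>

text \<open>
  No single HOL type contains all the sets \<open>V\<^sub>\<sigma>\<close>, because each arrow is interpreted by the full
  function space.  The hierarchy is therefore coded in an arbitrary type \<open>'u\<close>: \<open>tree_code\<close>
  codes trees, and \<open>fun_code E \<sigma>\<close> codes functions with domain \<open>V\<^sub>\<sigma>\<close>, represented extensionally
  (they are \<open>undefined\<close> outside \<open>V\<^sub>\<sigma>\<close>).  \<open>tree_of\<close> and \<open>app\<close> decode.
\<close>

record 'u coding =
  tree_code :: "nat dtree \<Rightarrow> 'u"
  tree_of :: "'u \<Rightarrow> nat dtree"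
  fun_code :: "ty \<Rightarrow> ('u \<Rightarrow> 'u) \<Rightarrow> 'u"
  app :: "'u \<Rightarrow> 'u \<Rightarrow> 'u"

primrec V :: "'u coding \<Rightarrow> ty \<Rightarrow> 'u set" where
  "V E Iota = range (tree_code E)"
| "V E (\<sigma> \<Rrightarrow> \<tau>) = fun_code E \<sigma> ` (V E \<sigma> \<rightarrow>\<^sub>E V E \<tau>)"

text \<open>
  Up to level \<open>k\<close> decoding inverts coding, so that \<open>V E Iota\<close> is in bijection with the set of all
  dialogue trees and \<open>V E (\<sigma> \<Rrightarrow> \<tau>)\<close> with the set of all functions from \<open>V E \<sigma>\<close> to \<open>V E \<tau>\<close>
  whenever \<open>lev (\<sigma> \<Rrightarrow> \<tau>) \<le> k\<close>.  A bound on the levels is necessary for a coding to exist;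
  for each particular \<open>k\<close> there is one (lemmas \<open>faithful_0\<close> and \<open>faithful_Suc\<close> below).
\<close>
definition faithful :: "nat \<Rightarrow> 'u coding \<Rightarrow> bool" where
  "faithful k E \<longleftrightarrow>
     (\<forall>d. tree_of E (tree_code E d) = d) \<and>
     (\<forall>\<sigma> \<tau>. lev (\<sigma> \<Rrightarrow> \<tau>) \<le> k \<longrightarrow>
        (\<forall>f \<in> V E \<sigma> \<rightarrow>\<^sub>E V E \<tau>. \<forall>a \<in> V E \<sigma>. app E (fun_code E \<sigma> f) a = f a))"

definition fn :: "'u coding \<Rightarrow> ty \<Rightarrow> ('u \<Rightarrow> 'u) \<Rightarrow> 'u" where
  "fn E \<sigma> f = fun_code E \<sigma> (restrict f (V E \<sigma>))"

primrec tgraft :: "'u coding \<Rightarrow> ty \<Rightarrow> 'x dtree \<Rightarrow> ('x \<Rightarrow> 'u) \<Rightarrow> 'u" where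
  "tgraft E Iota d g = tree_code E (graft d (\<lambda>x. tree_of E (g x)))"
| "tgraft E (\<sigma> \<Rrightarrow> \<tau>) d g = fn E \<sigma> (\<lambda>a. tgraft E \<tau> d (\<lambda>x. app E (g x) a))"

definition gen :: "'u coding \<Rightarrow> 'u" where
  "gen E = fn E Iota (\<lambda>d. tree_code E (graft (tree_of E d) (\<lambda>i. Node i (\<lambda>n. Leaf n))))"


section \<open>The source language\<close>

text \<open>
  Variables are de Bruijn indices; contexts and valuations are lists with the innermost binder
  first.
\<close>

datatype src =
    SVar nat
  | SLam ty src
  | SApp src src
  | Zero
  | Succ
  | Rec ty
  | Omega

definition rec_ty :: "ty \<Rightarrow> ty" where
  "rec_ty \<sigma> = (Iota \<Rrightarrow> \<sigma> \<Rrightarrow> \<sigma>) \<Rrightarrow> \<sigma> \<Rrightarrow> Iota \<Rrightarrow> \<sigma>"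

inductive styped :: "ty list \<Rightarrow> src \<Rightarrow> ty \<Rightarrow> bool" where
  "i < length \<Gamma> \<Longrightarrow> styped \<Gamma> (SVar i) (\<Gamma> ! i)"
| "styped (\<sigma> # \<Gamma>) u \<tau> \<Longrightarrow> styped \<Gamma> (SLam \<sigma> u) (\<sigma> \<Rrightarrow> \<tau>)"
| "styped \<Gamma> u (\<sigma> \<Rrightarrow> \<tau>) \<Longrightarrow> styped \<Gamma> v \<sigma> \<Longrightarrow> styped \<Gamma> (SApp u v) \<tau>"
| "styped \<Gamma> Zero Iota"
| "styped \<Gamma> Succ (Iota \<Rrightarrow> Iota)"
| "styped \<Gamma> (Rec \<sigma>) (rec_ty \<sigma>)"
| "styped \<Gamma> Omega (Iota \<Rrightarrow> Iota)"

text \<open>System T proper: the terms without the extra constant.\<close>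
primrec system_T :: "src \<Rightarrow> bool" where
  "system_T (SVar i) \<longleftrightarrow> True"
| "system_T (SLam \<sigma> u) \<longleftrightarrow> system_T u"
| "system_T (SApp u v) \<longleftrightarrow> system_T u \<and> system_T v"
| "system_T Zero \<longleftrightarrow> True"
| "system_T Succ \<longleftrightarrow> True"
| "system_T (Rec \<sigma>) \<longleftrightarrow> True"
| "system_T Omega \<longleftrightarrow> False"

text \<open>The unique type of a typable term.\<close>
primrec sty :: "ty list \<Rightarrow> src \<Rightarrow> ty" where
  "sty \<Gamma> (SVar i) = \<Gamma> ! i"
| "sty \<Gamma> (SLam \<sigma> u) = \<sigma> \<Rrightarrow> sty (\<sigma> # \<Gamma>) u"
| "sty \<Gamma> (SApp u v) = cod (sty \<Gamma> u)"
| "sty \<Gamma> Zero = Iota"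
| "sty \<Gamma> Succ = Iota \<Rrightarrow> Iota"
| "sty \<Gamma> (Rec \<sigma>) = rec_ty \<sigma>"
| "sty \<Gamma> Omega = Iota \<Rrightarrow> Iota"

lemma sty_eq: "styped \<Gamma> u \<sigma> \<Longrightarrow> sty \<Gamma> u = \<sigma>"
  by (induction rule: styped.induct) auto

primrec ceil :: "ty list \<Rightarrow> src \<Rightarrow> nat" where
  "ceil \<Gamma> (SVar i) = lev (\<Gamma> ! i)"
| "ceil \<Gamma> (SLam \<sigma> u) = max (lev (\<sigma> \<Rrightarrow> sty (\<sigma> # \<Gamma>) u)) (ceil (\<sigma> # \<Gamma>) u)"
| "ceil \<Gamma> (SApp u v) = max (lev (sty \<Gamma> (SApp u v))) (max (ceil \<Gamma> u) (ceil \<Gamma> v))"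
| "ceil \<Gamma> Zero = 0"
| "ceil \<Gamma> Succ = 1"
| "ceil \<Gamma> (Rec \<sigma>) = lev (rec_ty \<sigma>)"
| "ceil \<Gamma> Omega = 1"

definition K :: "src \<Rightarrow> nat" where
  "K t = ceil [] (SApp t Omega)"

text \<open>
  The clause for \<open>Omega\<close> only makes the function total; the interpretation is used on terms of
  System T proper.
\<close>
primrec ssem :: "'u coding \<Rightarrow> 'u list \<Rightarrow> src \<Rightarrow> 'u" where
  "ssem E \<gamma> (SVar i) = \<gamma> ! i"
| "ssem E \<gamma> (SLam \<sigma> u) = fn E \<sigma> (\<lambda>a. ssem E (a # \<gamma>) u)"
| "ssem E \<gamma> (SApp u v) = app E (ssem E \<gamma> u) (ssem E \<gamma> v)"
| "ssem E \<gamma> Zero = tree_code E (Leaf 0)"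
| "ssem E \<gamma> Succ = fn E Iota (\<lambda>d. tree_code E (tree_map (\<lambda>n. n + 1) (tree_of E d)))"
| "ssem E \<gamma> (Rec \<sigma>) =
     fn E (Iota \<Rrightarrow> \<sigma> \<Rrightarrow> \<sigma>) (\<lambda>f. fn E \<sigma> (\<lambda>a. fn E Iota (\<lambda>d.
       tgraft E \<sigma> (tree_of E d)
         (rec_nat a (\<lambda>n v. app E (app E f (tree_code E (Leaf n))) v)))))"
| "ssem E \<gamma> Omega = gen E"

definition dialogue :: "'u coding \<Rightarrow> src \<Rightarrow> nat dtree" where
  "dialogue E t = tree_of E (app E (ssem E [] t) (gen E))"


section \<open>Infinitary terms\<close>

datatype tm =
    Var nat
  | Lam ty tm
  | App tm tm
  | Lit nat
  | Query nat "nat \<Rightarrow> tm"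
  | Case tm "nat \<Rightarrow> tm"

inductive typed :: "ty list \<Rightarrow> tm \<Rightarrow> ty \<Rightarrow> bool" where
  "i < length \<Gamma> \<Longrightarrow> typed \<Gamma> (Var i) (\<Gamma> ! i)"
| "typed (\<sigma> # \<Gamma>) M \<tau> \<Longrightarrow> typed \<Gamma> (Lam \<sigma> M) (\<sigma> \<Rrightarrow> \<tau>)"
| "typed \<Gamma> F (\<sigma> \<Rrightarrow> \<tau>) \<Longrightarrow> typed \<Gamma> N \<sigma> \<Longrightarrow> typed \<Gamma> (App F N) \<tau>"
| "typed \<Gamma> (Lit n) Iota"
| "(\<And>n. typed \<Gamma> (Ms n) Iota) \<Longrightarrow> typed \<Gamma> (Query i Ms) Iota"
| "typed \<Gamma> M Iota \<Longrightarrow> (\<And>n. typed \<Gamma> (Ms n) Iota) \<Longrightarrow> typed \<Gamma> (Case M Ms) Iota"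

text \<open>The unique type of a typable term.\<close>
primrec ty_of :: "ty list \<Rightarrow> tm \<Rightarrow> ty" where
  "ty_of \<Gamma> (Var i) = \<Gamma> ! i"
| "ty_of \<Gamma> (Lam \<sigma> M) = \<sigma> \<Rrightarrow> ty_of (\<sigma> # \<Gamma>) M"
| "ty_of \<Gamma> (App F N) = cod (ty_of \<Gamma> F)"
| "ty_of \<Gamma> (Lit n) = Iota"
| "ty_of \<Gamma> (Query i Ms) = Iota"
| "ty_of \<Gamma> (Case M Ms) = Iota"

lemma ty_of_eq: "typed \<Gamma> M \<sigma> \<Longrightarrow> ty_of \<Gamma> M = \<sigma>"
  by (induction rule: typed.induct) auto

primrec isem :: "'u coding \<Rightarrow> 'u list \<Rightarrow> tm \<Rightarrow> 'u" where
  "isem E \<gamma> (Var i) = \<gamma> ! i"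
| "isem E \<gamma> (Lam \<sigma> M) = fn E \<sigma> (\<lambda>a. isem E (a # \<gamma>) M)"
| "isem E \<gamma> (App F N) = app E (isem E \<gamma> F) (isem E \<gamma> N)"
| "isem E \<gamma> (Lit n) = tree_code E (Leaf n)"
| "isem E \<gamma> (Query i Ms) = tree_code E (Node i (\<lambda>n. tree_of E (isem E \<gamma> (Ms n))))"
| "isem E \<gamma> (Case M Ms) =
     tree_code E (graft (tree_of E (isem E \<gamma> M)) (\<lambda>n. tree_of E (isem E \<gamma> (Ms n))))"

primrec subterms :: "tm \<Rightarrow> tm set" where
  "subterms (Var i) = {Var i}"
| "subterms (Lam \<sigma> M) = insert (Lam \<sigma> M) (subterms M)"
| "subterms (App F N) = insert (App F N) (subterms F \<union> subterms N)"
| "subterms (Lit n) = {Lit n}"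
| "subterms (Query i Ms) = insert (Query i Ms) (\<Union>n. subterms (Ms n))"
| "subterms (Case M Ms) = insert (Case M Ms) (subterms M \<union> (\<Union>n. subterms (Ms n)))"

definition beta_normal :: "tm \<Rightarrow> bool" where
  "beta_normal M \<longleftrightarrow> (\<nexists>\<sigma> U N. App (Lam \<sigma> U) N \<in> subterms M)"

text \<open>\<open>lift k M\<close> makes room for a new variable with index \<open>k\<close>.\<close>
primrec lift :: "nat \<Rightarrow> tm \<Rightarrow> tm" where
  "lift k (Var i) = (if i < k then Var i else Var (Suc i))"
| "lift k (Lam \<sigma> M) = Lam \<sigma> (lift (Suc k) M)"
| "lift k (App F N) = App (lift k F) (lift k N)"
| "lift k (Lit n) = Lit n"
| "lift k (Query i Ms) = Query i (\<lambda>n. lift k (Ms n))"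
| "lift k (Case M Ms) = Case (lift k M) (\<lambda>n. lift k (Ms n))"

text \<open>\<open>subst k N M\<close> replaces the variable with index \<open>k\<close> by \<open>N\<close> in \<open>M\<close> and removes that variable
  from the context.\<close>
primrec subst :: "nat \<Rightarrow> tm \<Rightarrow> tm \<Rightarrow> tm" where
  "subst k N (Var i) = (if i < k then Var i else if i = k then N else Var (i - 1))"
| "subst k N (Lam \<sigma> M) = Lam \<sigma> (subst (Suc k) (lift 0 N) M)"
| "subst k N (App F M) = App (subst k N F) (subst k N M)"
| "subst k N (Lit n) = Lit n"
| "subst k N (Query i Ms) = Query i (\<lambda>n. subst k N (Ms n))"
| "subst k N (Case M Ms) = Case (subst k N M) (\<lambda>n. subst k N (Ms n))"

primrec tcase :: "ty \<Rightarrow> tm \<Rightarrow> (nat \<Rightarrow> tm) \<Rightarrow> tm" where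
  "tcase Iota M Ms = Case M Ms"
| "tcase (\<sigma> \<Rrightarrow> \<tau>) M Ms = Lam \<sigma> (tcase \<tau> (lift 0 M) (\<lambda>n. App (lift 0 (Ms n)) (Var 0)))"


section \<open>Translation and passes\<close>

primrec iter :: "tm \<Rightarrow> tm \<Rightarrow> nat \<Rightarrow> tm" where
  "iter f a 0 = a"
| "iter f a (Suc n) = App (App f (Lit n)) (iter f a n)"

definition Rec_inf :: "ty \<Rightarrow> tm" where
  "Rec_inf \<sigma> = Lam (Iota \<Rrightarrow> \<sigma> \<Rrightarrow> \<sigma>) (Lam \<sigma> (Lam Iota
     (tcase \<sigma> (Var 0) (\<lambda>n. iter (Var 2) (Var 1) n))))"

primrec hat :: "src \<Rightarrow> tm" where
  "hat (SVar i) = Var i"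
| "hat (SLam \<sigma> u) = Lam \<sigma> (hat u)"
| "hat (SApp u v) = App (hat u) (hat v)"
| "hat Zero = Lit 0"
| "hat Succ = Lam Iota (Case (Var 0) (\<lambda>n. Lit (n + 1)))"
| "hat (Rec \<sigma>) = Rec_inf \<sigma>"
| "hat Omega = Lam Iota (Case (Var 0) (\<lambda>i. Query i (\<lambda>n. Lit n)))"

text \<open>The context is needed only to determine the type of the function part of an application.\<close>
primrec pass :: "nat \<Rightarrow> ty list \<Rightarrow> tm \<Rightarrow> tm" where
  "pass r \<Gamma> (Var i) = Var i"
| "pass r \<Gamma> (Lam \<sigma> M) = Lam \<sigma> (pass r (\<sigma> # \<Gamma>) M)"
| "pass r \<Gamma> (App F N) =
     (case pass r \<Gamma> F of
        Lam \<sigma> U \<Rightarrow> if lev (ty_of \<Gamma> F) = r then subst 0 (pass r \<Gamma> N) U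
                    else App (Lam \<sigma> U) (pass r \<Gamma> N)
      | F' \<Rightarrow> App F' (pass r \<Gamma> N))"
| "pass r \<Gamma> (Lit n) = Lit n"
| "pass r \<Gamma> (Query i Ms) = Query i (\<lambda>n. pass r \<Gamma> (Ms n))"
| "pass r \<Gamma> (Case M Ms) = Case (pass r \<Gamma> M) (\<lambda>n. pass r \<Gamma> (Ms n))"

primrec passes :: "nat \<Rightarrow> ty list \<Rightarrow> tm \<Rightarrow> tm" where
  "passes 0 \<Gamma> M = M"
| "passes (Suc r) \<Gamma> M = passes r \<Gamma> (pass (Suc r) \<Gamma> M)"

definition M_of :: "src \<Rightarrow> tm" where
  "M_of t = hat (SApp t Omega)"

definition N_of :: "src \<Rightarrow> tm" where
  "N_of t = passes (K t) [] (M_of t)"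


section \<open>Existence of faithful codings\<close>

lemma faithful_0: "\<exists>E :: nat dtree coding. faithful 0 E"
  by (rule exI[of _ "\<lparr>tree_code = id, tree_of = id, fun_code = undefined, app = undefined\<rparr>"])
     (simp add: faithful_def)

lemma fun_code_eqI:
  assumes "faithful k E" "lev (\<sigma> \<Rrightarrow> \<tau>) \<le> k" "v \<in> V E (\<sigma> \<Rrightarrow> \<tau>)" "w \<in> V E (\<sigma> \<Rrightarrow> \<tau>)"
    and "\<And>a. a \<in> V E \<sigma> \<Longrightarrow> app E v a = app E w a"
  shows "v = w"
proof -
  obtain f g where f: "v = fun_code E \<sigma> f" "f \<in> V E \<sigma> \<rightarrow>\<^sub>E V E \<tau>"
    and g: "w = fun_code E \<sigma> g" "g \<in> V E \<sigma> \<rightarrow>\<^sub>E V E \<tau>" using assms(3,4) by auto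
  have "f a = g a" if "a \<in> V E \<sigma>" for a
    using assms(5)[OF that] f g that assms(1,2) unfolding faithful_def by metis
  then have "f = g" using f(2) g(2) by (meson PiE_ext)
  then show ?thesis using f g by simp
qed

text \<open>Re-coding of \<open>V E \<sigma>\<close> in a larger type; the empty list carries the argument type.\<close>
primrec recode :: "'u coding \<Rightarrow> ty \<Rightarrow> 'u \<Rightarrow> 'u list \<Rightarrow> ty \<times> nat dtree" where
  "recode E Iota x = (\<lambda>_. (Iota, tree_of E x))"
| "recode E (\<sigma> \<Rrightarrow> \<tau>) x = (\<lambda>l. case l of [] \<Rightarrow> (\<sigma>, Leaf 0)
     | a # l' \<Rightarrow> if a \<in> V E \<sigma> then recode E \<tau> (app E x a) l' else (Iota, Leaf 0))"

definition enlarge :: "'u coding \<Rightarrow> ('u list \<Rightarrow> ty \<times> nat dtree) coding" where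
  "enlarge E = \<lparr>
     tree_code = (\<lambda>d _. (Iota, d)),
     tree_of = (\<lambda>v. snd (v [])),
     fun_code = (\<lambda>\<sigma> f l. case l of [] \<Rightarrow> (\<sigma>, Leaf 0)
       | a # l' \<Rightarrow> if a \<in> V E \<sigma> then f (recode E \<sigma> a) l' else (Iota, Leaf 0)),
     app = (\<lambda>v b l. v (inv_into (V E (fst (v []))) (recode E (fst (v []))) b # l))\<rparr>"

lemma recode_bij:
  assumes E: "faithful k E"
  shows "lev \<sigma> \<le> k \<Longrightarrow> bij_betw (recode E \<sigma>) (V E \<sigma>) (V (enlarge E) \<sigma>)"
proof (induction \<sigma>)
  case Iota
  have "tree_of E (tree_code E d) = d" for d using E by (simp add: faithful_def)
  then show ?case
    by (auto simp: bij_betw_def inj_on_def enlarge_def image_iff fun_eq_iff)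
next
  case (Fun \<sigma> \<tau>)
  have b1: "bij_betw (recode E \<sigma>) (V E \<sigma>) (V (enlarge E) \<sigma>)"
    and b2: "bij_betw (recode E \<tau>) (V E \<tau>) (V (enlarge E) \<tau>)" using Fun by auto
  have beta: "app E (fun_code E \<sigma> f) a = f a" if "f \<in> V E \<sigma> \<rightarrow>\<^sub>E V E \<tau>" "a \<in> V E \<sigma>" for f a
    using E Fun.prems that unfolding faithful_def by blast
  have app_in: "app E x a \<in> V E \<tau>" if "x \<in> V E (\<sigma> \<Rrightarrow> \<tau>)" "a \<in> V E \<sigma>" for x a
    using that beta by auto
  have inj: "inj_on (recode E (\<sigma> \<Rrightarrow> \<tau>)) (V E (\<sigma> \<Rrightarrow> \<tau>))"
  proof (rule inj_onI)
    fix x y assume x: "x \<in> V E (\<sigma> \<Rrightarrow> \<tau>)" and y: "y \<in> V E (\<sigma> \<Rrightarrow> \<tau>)"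
      and eq: "recode E (\<sigma> \<Rrightarrow> \<tau>) x = recode E (\<sigma> \<Rrightarrow> \<tau>) y"
    show "x = y"
    proof (rule fun_code_eqI[OF E Fun.prems x y])
      fix a assume a: "a \<in> V E \<sigma>"
      have "recode E \<tau> (app E x a) l = recode E \<tau> (app E y a) l" for l
        using fun_cong[OF eq, of "a # l"] a by simp
      then have "recode E \<tau> (app E x a) = recode E \<tau> (app E y a)" by blast
      then show "app E x a = app E y a"
        using b2 app_in[OF x a] app_in[OF y a] by (meson bij_betw_def inj_onD)
    qed
  qed
  have sub: "recode E (\<sigma> \<Rrightarrow> \<tau>) x \<in> V (enlarge E) (\<sigma> \<Rrightarrow> \<tau>)" if x: "x \<in> V E (\<sigma> \<Rrightarrow> \<tau>)" for x
  proof -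
    define f where "f = (\<lambda>b \<in> V (enlarge E) \<sigma>.
      recode E \<tau> (app E x (inv_into (V E \<sigma>) (recode E \<sigma>) b)))"
    have f: "f \<in> V (enlarge E) \<sigma> \<rightarrow>\<^sub>E V (enlarge E) \<tau>"
      unfolding f_def using b1 b2 app_in[OF x]
      by (auto simp: bij_betw_def intro!: imageI inv_into_into)
        (metis imageI inv_into_into)
    have fa: "f (recode E \<sigma> a) = recode E \<tau> (app E x a)" if "a \<in> V E \<sigma>" for a
      using that b1 unfolding f_def by (auto simp: bij_betw_def)
    have "recode E (\<sigma> \<Rrightarrow> \<tau>) x = fun_code (enlarge E) \<sigma> f"
      by (auto simp: enlarge_def fun_eq_iff fa split: list.split)
    then show ?thesis using f by auto
  qed
  have sup: "\<exists>x \<in> V E (\<sigma> \<Rrightarrow> \<tau>). fun_code (enlarge E) \<sigma> f = recode E (\<sigma> \<Rrightarrow> \<tau>) x"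
    if f: "f \<in> V (enlarge E) \<sigma> \<rightarrow>\<^sub>E V (enlarge E) \<tau>" for f
  proof -
    define g where "g = (\<lambda>a \<in> V E \<sigma>. inv_into (V E \<tau>) (recode E \<tau>) (f (recode E \<sigma> a)))"
    have mem: "f (recode E \<sigma> a) \<in> recode E \<tau> ` V E \<tau>" if "a \<in> V E \<sigma>" for a
      using that f b1 b2 by (auto simp: bij_betw_def)
    have g: "g \<in> V E \<sigma> \<rightarrow>\<^sub>E V E \<tau>"
      unfolding g_def using mem by (auto intro: inv_into_into)
    have "recode E \<tau> (app E (fun_code E \<sigma> g) a) = f (recode E \<sigma> a)" if a: "a \<in> V E \<sigma>" for a
      using beta[OF g a] mem[OF a] a by (simp add: g_def f_inv_into_f)
    then have "fun_code (enlarge E) \<sigma> f = recode E (\<sigma> \<Rrightarrow> \<tau>) (fun_code E \<sigma> g)"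
      by (auto simp: enlarge_def fun_eq_iff split: list.split)
    then show ?thesis using g by auto
  qed
  have "V (enlarge E) (\<sigma> \<Rrightarrow> \<tau>) \<subseteq> recode E (\<sigma> \<Rrightarrow> \<tau>) ` V E (\<sigma> \<Rrightarrow> \<tau>)"
  proof
    fix y assume "y \<in> V (enlarge E) (\<sigma> \<Rrightarrow> \<tau>)"
    then obtain f where "y = fun_code (enlarge E) \<sigma> f" "f \<in> V (enlarge E) \<sigma> \<rightarrow>\<^sub>E V (enlarge E) \<tau>"
      by auto
    with sup show "y \<in> recode E (\<sigma> \<Rrightarrow> \<tau>) ` V E (\<sigma> \<Rrightarrow> \<tau>)" by blast
  qed
  with inj sub show ?case unfolding bij_betw_def by blast
qed

lemma faithful_Suc:
  fixes E :: "'u coding"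
  assumes E: "faithful k E"
  shows "faithful (Suc k) (enlarge E)"
  unfolding faithful_def
proof (intro conjI allI impI ballI)
  show "tree_of (enlarge E) (tree_code (enlarge E) d) = d" for d
    by (simp add: enlarge_def)
next
  fix \<sigma> \<tau> f b
  assume l: "lev (\<sigma> \<Rrightarrow> \<tau>) \<le> Suc k" and b: "b \<in> V (enlarge E) \<sigma>"
  have "bij_betw (recode E \<sigma>) (V E \<sigma>) (V (enlarge E) \<sigma>)"
    using recode_bij[OF E] l by simp
  then have "b \<in> recode E \<sigma> ` V E \<sigma>" using b by (simp add: bij_betw_def)
  then show "app (enlarge E) (fun_code (enlarge E) \<sigma> f) b = f b"
    by (simp add: enlarge_def inv_into_into f_inv_into_f)
qed

end

(* A single typing judgement carries two bounds: one on the levels of the types of all subterms,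
   under which a faithful coding interprets beta reduction soundly, and one on the levels of the
   redexes.  A pass at level r contracts all redexes of level r.  The redexes that it creates
   have the level of a substituted variable or of the result of a contraction, hence a level
   below r or one that the pass meets again on its way up.  Each pass therefore lowers the second
   bound by one, and at bound 0 no redex remains because arrow types have positive level. *)
theory Submission
  imports Defs
begin

section \<open>Typing with level bounds, and its stability under substitution\<close>

definition is_Lam :: "tm \<Rightarrow> bool" where
  "is_Lam M \<longleftrightarrow> (\<exists>\<sigma> U. M = Lam \<sigma> U)"

lemma is_Lam_simps [simp]:
  "\<not> is_Lam (Var i)" "is_Lam (Lam \<sigma> M)" "\<not> is_Lam (App F N)" "\<not> is_Lam (Lit n)"
  "\<not> is_Lam (Query i Ms)" "\<not> is_Lam (Case M Ms)"
  by (auto simp: is_Lam_def)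

lemma is_Lam_lift [simp]: "is_Lam (lift k M) \<longleftrightarrow> is_Lam M"
  by (cases M) auto

text \<open>Substitution keeps every outermost constructor except that of the replaced variable, so
  a new redex can arise only where this variable is applied.\<close>

lemma is_Lam_subst: "is_Lam (subst k N M) \<Longrightarrow> is_Lam M \<or> M = Var k"
  by (cases M) (auto split: if_splits)

text \<open>\<open>k\<close> bounds the levels of the types of all subterms, \<open>d\<close> those of the function parts of
  redexes.\<close>
inductive wt :: "nat \<Rightarrow> nat \<Rightarrow> ty list \<Rightarrow> tm \<Rightarrow> ty \<Rightarrow> bool" for k d where
  wt_Var: "i < length \<Gamma> \<Longrightarrow> \<Gamma> ! i = \<sigma> \<Longrightarrow> lev \<sigma> \<le> k \<Longrightarrow> wt k d \<Gamma> (Var i) \<sigma>"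
| wt_Lam: "wt k d (\<sigma> # \<Gamma>) M \<tau> \<Longrightarrow> lev (\<sigma> \<Rrightarrow> \<tau>) \<le> k \<Longrightarrow> wt k d \<Gamma> (Lam \<sigma> M) (\<sigma> \<Rrightarrow> \<tau>)"
| wt_App: "wt k d \<Gamma> F (\<sigma> \<Rrightarrow> \<tau>) \<Longrightarrow> wt k d \<Gamma> N \<sigma> \<Longrightarrow> (is_Lam F \<Longrightarrow> lev (\<sigma> \<Rrightarrow> \<tau>) \<le> d)
    \<Longrightarrow> wt k d \<Gamma> (App F N) \<tau>"
| wt_Lit: "wt k d \<Gamma> (Lit n) Iota"
| wt_Query: "(\<And>n. wt k d \<Gamma> (Ms n) Iota) \<Longrightarrow> wt k d \<Gamma> (Query i Ms) Iota"
| wt_Case: "wt k d \<Gamma> M Iota \<Longrightarrow> (\<And>n. wt k d \<Gamma> (Ms n) Iota) \<Longrightarrow> wt k d \<Gamma> (Case M Ms) Iota"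

lemma wt_typed: "wt k d \<Gamma> M \<sigma> \<Longrightarrow> typed \<Gamma> M \<sigma>"
  by (induction rule: wt.induct) (auto intro: typed.intros)

lemma wt_lev: "wt k d \<Gamma> M \<sigma> \<Longrightarrow> lev \<sigma> \<le> k"
  by (induction rule: wt.induct) auto

lemma wt_lift:
  "wt k d \<Gamma> M \<tau> \<Longrightarrow> \<Gamma> = \<Delta> @ \<Gamma>2 \<Longrightarrow> wt k d (\<Delta> @ \<sigma> # \<Gamma>2) (lift (length \<Delta>) M) \<tau>"
proof (induction arbitrary: \<Delta> rule: wt.induct)
  case (wt_Lam \<rho> \<Gamma> M \<tau>)
  then show ?case using wt_Lam.IH[of "\<rho> # \<Delta>"] by (auto intro: wt.wt_Lam)
qed (auto intro!: wt.intros simp: nth_append intro: wt.wt_App)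

lemmas wt_lift0 = wt_lift[where \<Delta> = "[]", simplified]

text \<open>The substitution creates redexes at the level of the variable only.\<close>
lemma wt_subst:
  "wt k d \<Gamma> M \<tau> \<Longrightarrow> \<Gamma> = \<Delta> @ \<sigma> # \<Gamma>2 \<Longrightarrow> wt k d (\<Delta> @ \<Gamma>2) N \<sigma> \<Longrightarrow> lev \<sigma> \<le> d
    \<Longrightarrow> wt k d (\<Delta> @ \<Gamma>2) (subst (length \<Delta>) N M) \<tau>"
proof (induction arbitrary: \<Delta> N rule: wt.induct)
  case (wt_Var i \<Gamma> \<tau>)
  then show ?case by (auto intro!: wt.wt_Var simp: nth_append nth_Cons')
next
  case (wt_Lam \<rho> \<Gamma> M \<tau>)
  then show ?case
    using wt_Lam.IH[of "\<rho> # \<Delta>" "lift 0 N"] wt_lift0[OF wt_Lam.prems(2), where \<sigma> = \<rho>]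
    by (auto intro: wt.wt_Lam)
next
  case (wt_App \<Gamma> F \<rho> \<tau> M)
  have "lev (\<rho> \<Rrightarrow> \<tau>) \<le> d" if "is_Lam (subst (length \<Delta>) N F)"
    using is_Lam_subst[OF that]
  proof
    \<comment> \<open>Uniqueness of types makes the arrow type of \<open>F\<close> the type of the
      replaced variable, whose level is at most \<open>d\<close>.\<close>
    assume "F = Var (length \<Delta>)"
    then have "\<sigma> = \<rho> \<Rrightarrow> \<tau>"
      using ty_of_eq[OF wt_typed[OF wt_App.hyps(1)]] wt_App.prems by simp
    then show ?thesis using wt_App.prems by simp
  qed (use wt_App in blast)
  moreover have "wt k d (\<Delta> @ \<Gamma>2) (subst (length \<Delta>) N F) (\<rho> \<Rrightarrow> \<tau>)"
    "wt k d (\<Delta> @ \<Gamma>2) (subst (length \<Delta>) N M) \<rho>"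
    using wt_App.IH wt_App.prems by blast+
  ultimately show ?case unfolding subst.simps by (blast intro: wt.wt_App)
qed (auto intro: wt.intros)

lemma wt_beta_normal:
  assumes "wt k 0 \<Gamma> M \<sigma>"
  shows "beta_normal M"
proof -
  have "App (Lam \<rho> U) N \<notin> subterms M" for \<rho> U N
    using assms by (induction rule: wt.induct) auto
  then show ?thesis by (simp add: beta_normal_def)
qed


section \<open>Values of infinitary terms in a faithful coding\<close>

definition env :: "'u coding \<Rightarrow> ty list \<Rightarrow> 'u list \<Rightarrow> bool" where
  "env E \<Gamma> \<gamma> \<longleftrightarrow> list_all2 (\<lambda>\<sigma> a. a \<in> V E \<sigma>) \<Gamma> \<gamma>"

lemma env_simps [simp]:
  "env E [] []" "env E (\<sigma> # \<Gamma>) (a # \<gamma>) \<longleftrightarrow> a \<in> V E \<sigma> \<and> env E \<Gamma> \<gamma>"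
  by (auto simp: env_def)

lemma faithful_tree: "faithful k E \<Longrightarrow> tree_of E (tree_code E d) = d"
  by (simp add: faithful_def)

lemma fn_in_V: "(\<And>a. a \<in> V E \<sigma> \<Longrightarrow> f a \<in> V E \<tau>) \<Longrightarrow> fn E \<sigma> f \<in> V E (\<sigma> \<Rrightarrow> \<tau>)"
  unfolding fn_def by auto

lemma fn_cong: "(\<And>a. a \<in> V E \<sigma> \<Longrightarrow> f a = g a) \<Longrightarrow> fn E \<sigma> f = fn E \<sigma> g"
  unfolding fn_def by (metis restrict_ext)

text \<open>Decoding is guaranteed only for functions from \<open>V E \<sigma>\<close> to
  \<open>V E \<tau>\<close> of level at most \<open>k\<close>; the soundness of beta reduction rests
  on this equation.\<close>

lemma app_fn:
  assumes "faithful k E" "lev (\<sigma> \<Rrightarrow> \<tau>) \<le> k" "\<And>a. a \<in> V E \<sigma> \<Longrightarrow> f a \<in> V E \<tau>" "a \<in> V E \<sigma>"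
  shows "app E (fn E \<sigma> f) a = f a"
proof -
  have "restrict f (V E \<sigma>) \<in> V E \<sigma> \<rightarrow>\<^sub>E V E \<tau>" using assms(3) by auto
  then have "app E (fn E \<sigma> f) a = restrict f (V E \<sigma>) a"
    using assms(1,2,4) unfolding faithful_def fn_def by blast
  then show ?thesis using assms(4) by simp
qed

lemma app_in_V:
  assumes E: "faithful k E" and l: "lev (\<sigma> \<Rrightarrow> \<tau>) \<le> k"
    and v: "v \<in> V E (\<sigma> \<Rrightarrow> \<tau>)" and a: "a \<in> V E \<sigma>"
  shows "app E v a \<in> V E \<tau>"
proof -
  obtain f where f: "v = fun_code E \<sigma> f" "f \<in> V E \<sigma> \<rightarrow>\<^sub>E V E \<tau>" using v by auto
  then have "app E v a = f a" using E l a unfolding faithful_def by blast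
  then show ?thesis using f(2) a by auto
qed

lemma isem_in_V:
  assumes "faithful k E"
  shows "wt k d \<Gamma> M \<sigma> \<Longrightarrow> env E \<Gamma> \<gamma> \<Longrightarrow> isem E \<gamma> M \<in> V E \<sigma>"
proof (induction arbitrary: \<gamma> rule: wt.induct)
  case wt_Var
  then show ?case by (auto simp: env_def list_all2_conv_all_nth)
next
  case (wt_Lam \<sigma> \<Gamma> M \<tau>)
  then show ?case unfolding isem.simps by (intro fn_in_V) auto
next
  case (wt_App \<Gamma> F \<sigma> \<tau> N)
  show ?case unfolding isem.simps
    by (rule app_in_V[OF assms wt_lev[OF wt_App.hyps(1)]]) (use wt_App in blast)+
qed auto

lemma isem_lift: "isem E (\<delta> @ a # \<gamma>2) (lift (length \<delta>) M) = isem E (\<delta> @ \<gamma>2) M"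
proof (induction M arbitrary: \<delta>)
  case (Lam \<sigma> M)
  show ?case using Lam[of "_ # \<delta>"] by simp
qed (auto simp: nth_append nth_Cons' Suc_diff_le)

lemmas isem_lift0 = isem_lift[where \<delta> = "[]", simplified]

text \<open>The prefix \<open>\<delta>\<close> holds the values of the binders already crossed. Each
  further binder lifts \<open>N\<close>, which leaves its value unchanged by
  \<open>isem_lift0\<close>.\<close>

lemma isem_subst:
  "isem E (\<delta> @ \<gamma>2) (subst (length \<delta>) N M) = isem E (\<delta> @ isem E (\<delta> @ \<gamma>2) N # \<gamma>2) M"
proof (induction M arbitrary: \<delta> N)
  case (Lam \<sigma> M)
  show ?case using Lam[of "_ # \<delta>" "lift 0 N"] by (simp add: isem_lift0)
qed (auto simp: nth_append nth_Cons')

lemmas isem_subst0 = isem_subst[where \<delta> = "[]", simplified]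


section \<open>Elimination of redexes by the passes\<close>

text \<open>This reduces the case distinction on the constructors to contraction or none. The
  function part is inspected after the pass, its type is read off before.\<close>

lemma pass_App_cases:
  obtains (beta) \<rho> U where "pass r \<Gamma> F = Lam \<rho> U" "lev (ty_of \<Gamma> F) = r"
      "pass r \<Gamma> (App F N) = subst 0 (pass r \<Gamma> N) U"
  | (cong) "is_Lam (pass r \<Gamma> F) \<Longrightarrow> lev (ty_of \<Gamma> F) \<noteq> r"
      "pass r \<Gamma> (App F N) = App (pass r \<Gamma> F) (pass r \<Gamma> N)"
  by (cases "pass r \<Gamma> F"; cases "lev (ty_of \<Gamma> F) = r") (auto simp: is_Lam_def)

lemma wt_LamD:
  assumes "wt k d \<Gamma> (Lam \<rho> U) (\<sigma> \<Rrightarrow> \<tau>)"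
  shows "\<rho> = \<sigma>" "wt k d (\<sigma> # \<Gamma>) U \<tau>"
  using assms by (auto elim: wt.cases)

text \<open>The second conjunct bounds the level of the redexes that arise when the function part of an
  application becomes an abstraction.\<close>
lemma wt_pass:
  "wt k (Suc r) \<Gamma> M \<sigma> \<Longrightarrow> wt k r \<Gamma> (pass (Suc r) \<Gamma> M) \<sigma> \<and>
    (is_Lam (pass (Suc r) \<Gamma> M) \<longrightarrow> is_Lam M \<or> lev \<sigma> \<le> Suc r)"
proof (induction rule: wt.induct)
  case (wt_App \<Gamma> F \<sigma> \<tau> N)
  have ty: "ty_of \<Gamma> F = \<sigma> \<Rrightarrow> \<tau>" using wt_App.hyps(1) by (simp add: wt_typed ty_of_eq)
  show ?case
  proof (cases rule: pass_App_cases[of "Suc r" \<Gamma> F N])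
    case (beta \<rho> U)
    have "wt k r (\<sigma> # \<Gamma>) U \<tau>" using wt_App.IH(1) beta(1) wt_LamD by metis
    \<comment> \<open>The level of \<open>\<sigma> \<Rrightarrow> \<tau>\<close> is
      \<open>Suc r\<close>, hence \<open>lev \<sigma> \<le> r\<close>, as \<open>wt_subst\<close>
      demands, and \<open>lev \<tau> \<le> Suc r\<close>, which gives the second conjunct.\<close>
    then show ?thesis
      using wt_subst[of k r "\<sigma> # \<Gamma>" U \<tau> "[]" \<sigma> \<Gamma>] wt_App.IH(2) beta(2,3) ty by auto
  next
    case cong
    \<comment> \<open>An abstraction here was one before, with level bounded by the typing of the
      redex, or has become one, with level bounded by the second conjunct. Both bounds are
      \<open>Suc r\<close>, and level \<open>Suc r\<close> itself would have been
      contracted.\<close>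
    have "lev (\<sigma> \<Rrightarrow> \<tau>) \<le> r" if "is_Lam (pass (Suc r) \<Gamma> F)"
      using wt_App.IH(1) wt_App.hyps(3) cong(1) that ty by fastforce
    then show ?thesis
      using wt_App.IH cong(2) by (auto intro: wt.wt_App)
  qed
qed (auto intro: wt.intros)

text \<open>A contraction is \<open>app_fn\<close> followed by \<open>isem_subst0\<close>. The bound
  \<open>k\<close> on all types makes \<open>app_fn\<close> applicable at each redex.\<close>

lemma isem_pass:
  assumes E: "faithful k E"
  shows "wt k (Suc r) \<Gamma> M \<sigma> \<Longrightarrow> env E \<Gamma> \<gamma> \<Longrightarrow> isem E \<gamma> (pass (Suc r) \<Gamma> M) = isem E \<gamma> M"
proof (induction arbitrary: \<gamma> rule: wt.induct)
  case (wt_Lam \<sigma> \<Gamma> M \<tau>)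
  then show ?case by (auto intro: fn_cong)
next
  case (wt_App \<Gamma> F \<sigma> \<tau> N)
  show ?case
  proof (cases rule: pass_App_cases[of "Suc r" \<Gamma> F N])
    case (beta \<rho> U)
    have \<rho>: "\<rho> = \<sigma>" and U: "wt k r (\<sigma> # \<Gamma>) U \<tau>"
      using wt_pass[OF wt_App.hyps(1)] beta(1) wt_LamD by metis+
    have "isem E \<gamma> (App F N) = app E (fn E \<sigma> (\<lambda>a. isem E (a # \<gamma>) U)) (isem E \<gamma> N)"
      using wt_App.IH(1)[OF wt_App.prems] beta(1) \<rho> by simp
    also have "\<dots> = isem E (isem E \<gamma> N # \<gamma>) U"
      by (rule app_fn[OF E wt_lev[OF wt_App.hyps(1)]])
        (use isem_in_V[OF E] U wt_App in auto)
    also have "\<dots> = isem E \<gamma> (pass (Suc r) \<Gamma> (App F N))"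
      using wt_App.IH(2)[OF wt_App.prems] beta(3) by (simp add: isem_subst0)
    finally show ?thesis by simp
  next
    case cong
    then show ?thesis using wt_App by simp
  qed
qed auto

lemma wt_passes: "wt k r \<Gamma> M \<sigma> \<Longrightarrow> wt k 0 \<Gamma> (passes r \<Gamma> M) \<sigma>"
  by (induction r arbitrary: M) (auto dest: wt_pass)

lemma isem_passes:
  assumes "faithful k E" "env E \<Gamma> \<gamma>"
  shows "wt k r \<Gamma> M \<sigma> \<Longrightarrow> isem E \<gamma> (passes r \<Gamma> M) = isem E \<gamma> M"
proof (induction r arbitrary: M)
  case (Suc r)
  then show ?case using wt_pass[OF Suc.prems] isem_pass[OF assms(1) Suc.prems assms(2)] by simp
qed simp


section \<open>Translation of the source language\<close>

text \<open>The applications introduced at arrow types may be redexes. With both bounds equal to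
  \<open>k\<close>, the bound on types covers them.\<close>

lemma wt_tcase:
  assumes "wt k k \<Gamma> M Iota" "\<And>n. wt k k \<Gamma> (Ms n) \<sigma>" "lev \<sigma> \<le> k"
  shows "wt k k \<Gamma> (tcase \<sigma> M Ms) \<sigma>"
  using assms
proof (induction \<sigma> arbitrary: \<Gamma> M Ms)
  case (Fun \<sigma> \<tau>)
  have "wt k k (\<sigma> # \<Gamma>) (App (lift 0 (Ms n)) (Var 0)) \<tau>" for n
    using Fun.prems by (intro wt_App[of _ _ _ _ \<sigma>] wt_lift0 wt_Var) auto
  then have "wt k k (\<sigma> # \<Gamma>) (tcase \<tau> (lift 0 M) (\<lambda>n. App (lift 0 (Ms n)) (Var 0))) \<tau>"
    using Fun.prems by (intro Fun.IH wt_lift0) auto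
  then show ?case using Fun.prems(3) by (auto intro: wt_Lam)
qed (auto intro: wt_Case)

lemma wt_iter:
  assumes "wt k k \<Gamma> f (Iota \<Rrightarrow> \<sigma> \<Rrightarrow> \<sigma>)" "wt k k \<Gamma> a \<sigma>"
  shows "wt k k \<Gamma> (iter f a n) \<sigma>"
proof (induction n)
  case (Suc n)
  have l: "lev (Iota \<Rrightarrow> \<sigma> \<Rrightarrow> \<sigma>) \<le> k" using wt_lev[OF assms(1)] .
  have "wt k k \<Gamma> (App f (Lit n)) (\<sigma> \<Rrightarrow> \<sigma>)"
    by (rule wt_App[OF assms(1) wt_Lit l])
  then have "wt k k \<Gamma> (App (App f (Lit n)) (iter f a n)) \<sigma>"
    by (rule wt_App[OF _ Suc]) simp
  then show ?case by simp
qed (simp add: assms)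

lemma wt_Rec_inf:
  assumes "lev (rec_ty \<sigma>) \<le> k"
  shows "wt k k \<Gamma> (Rec_inf \<sigma>) (rec_ty \<sigma>)"
  using assms unfolding Rec_inf_def rec_ty_def
  by (auto intro!: wt_Lam wt_tcase wt_iter wt_Var)

text \<open>The ceiling bounds the types of all source subterms, and the translation of a constant
  has only subterms whose types occur in the type of that constant.\<close>

lemma wt_hat: "styped \<Gamma> u \<sigma> \<Longrightarrow> ceil \<Gamma> u \<le> k \<Longrightarrow> wt k k \<Gamma> (hat u) \<sigma>"
proof (induction rule: styped.induct)
  case (3 \<Gamma> u \<sigma> \<tau> v)
  then have "wt k k \<Gamma> (hat u) (\<sigma> \<Rrightarrow> \<tau>)" "wt k k \<Gamma> (hat v) \<sigma>" by auto
  then show ?case by (auto intro: wt_App dest: wt_lev)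
qed (auto intro!: wt_Var wt_Lam wt_Lit wt_Query wt_Case wt_Rec_inf simp: sty_eq)

text \<open>Both sides recurse on \<open>\<sigma>\<close> and code the same function at each arrow;
  \<open>isem_lift0\<close> removes the lifts.\<close>

lemma isem_tcase:
  "isem E \<gamma> (tcase \<sigma> M Ms) = tgraft E \<sigma> (tree_of E (isem E \<gamma> M)) (\<lambda>n. isem E \<gamma> (Ms n))"
  by (induction \<sigma> arbitrary: \<gamma> M Ms) (simp_all add: isem_lift0)

lemma isem_iter:
  "isem E \<gamma> (iter f a n) = rec_nat (isem E \<gamma> a)
     (\<lambda>n v. app E (app E (isem E \<gamma> f) (tree_code E (Leaf n))) v) n"
  by (induction n) simp_all

text \<open>Every constant and its translation unfold to the same coded function once
  \<open>faithful_tree\<close> cancels coded and decoded trees, so induction yields equal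
  values.\<close>

lemma isem_hat:
  assumes "faithful k E"
  shows "isem E \<gamma> (hat u) = ssem E \<gamma> u"
  by (induction u arbitrary: \<gamma>)
    (simp_all add: Rec_inf_def isem_tcase isem_iter gen_def tree_map_def faithful_tree[OF assms])

theorem theorem4:
  fixes t :: src
  assumes "system_T t"
    and "styped [] t ((Iota \<Rrightarrow> Iota) \<Rrightarrow> Iota)"
  shows "typed [] (N_of t) Iota \<and> beta_normal (N_of t) \<and>
    (\<forall>E :: 'u coding. faithful (K t) E \<longrightarrow>
       isem E [] (N_of t) = tree_code E (dialogue E t))"
proof -
  have "styped [] (SApp t Omega) Iota" using assms(2) by (auto intro: styped.intros)
  then have M: "wt (K t) (K t) [] (M_of t) Iota"
    unfolding M_of_def by (rule wt_hat) (simp add: K_def)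
  then have N: "wt (K t) 0 [] (N_of t) Iota" unfolding N_of_def by (rule wt_passes)
  have "isem E [] (N_of t) = tree_code E (dialogue E t)" if E: "faithful (K t) E" for E :: "'u coding"
  proof -
    have "isem E [] (N_of t) = isem E [] (M_of t)"
      unfolding N_of_def using isem_passes[OF E env_simps(1) M] .
    also have "\<dots> = app E (ssem E [] t) (gen E)"
      unfolding M_of_def isem_hat[OF E] by simp
    finally have eq: "isem E [] (N_of t) = app E (ssem E [] t) (gen E)" .
    \<comment> \<open>\<open>dialogue\<close> decodes the value; coding it again returns the value
      because a value of type \<open>Iota\<close> is the code of a tree.\<close>
    have "isem E [] (N_of t) \<in> range (tree_code E)" using isem_in_V[OF E N] by simp
    then show ?thesis unfolding dialogue_def eq[symmetric] by (auto simp: faithful_tree[OF E])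
  qed
  then show ?thesis using wt_typed[OF N] wt_beta_normal[OF N] by blast
qed

end
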